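(* For every $d\in\mathbb{N}$, there is a deterministic protocol for $\mathrm{Sp}_{d,n}^{d-1}$ with $O(\log^2 n)$ bits of communication.
   Context: Let $\Delta=\mathrm{conv}(v_0,\ldots,v_d)$ be the unit $d$-simplex and let $T$ be a triangulation of $\Delta$ with $n$ points (vertices). A coloring $c:T\to\{0,\ldots,d\}$ is a Sperner-coloring if $c(v_i)=i$ for all $i\in\{0,\ldots,d\}$ and every $x\in T$ gets the color of one of the vertices of the smallest face of $\Delta$ containing $x$. A $d$-simplex of the triangulation is panchromatic if its $d+1$ vertices receive all $d+1$ colors. The Concatenation Sperner problem $\mathrm{Sp}_{d,n}^t$ (for $t\le d<n$) is the two-player communication problem in which the triangulation $T$ (with points labeled by $[n]$) is publicly known, player $A$ is given a set $S_A\subset T$ and a coloring $c_A:S_A\to\{0,\ldots,t-1\}$ (i.e., the color classes of the first $t$ colors), and player $B$ is given a set $S_B\subset T$ and a coloring $c_B:S_B\to\{t,\ldots,d\}$ (the remaining color classes). Their goal is to output a panchromatic $d$-simplex of the triangulation, or to exhibit a point showing that the assumptions fail (e.g., that $S_A\dot\cup S_B=T$ does not hold, or that the combined coloring is not a Sperner-coloring). *)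

theory Defs
  imports "HOL-Analysis.Analysis" "HOL-Library.Landau_Symbols"
begin

text \<open>
  Protocol trees: at every inner node the owner announces one bit computed from their own input
  (the bits announced so far are encoded by the position in the tree), and the answer is read off
  from the leaf, so that it is known to both players.
\<close>

datatype ('x, 'y, 'z) protocol =
    Answer 'z
  | Ask_A "'x \<Rightarrow> bool" "('x, 'y, 'z) protocol" "('x, 'y, 'z) protocol"
  | Ask_B "'y \<Rightarrow> bool" "('x, 'y, 'z) protocol" "('x, 'y, 'z) protocol"

primrec run :: "('x, 'y, 'z) protocol \<Rightarrow> 'x \<Rightarrow> 'y \<Rightarrow> 'z" where
  "run (Answer z) x y = z"
| "run (Ask_A q P Q) x y = (if q x then run P x y else run Q x y)"
| "run (Ask_B q P Q) x y = (if q y then run P x y else run Q x y)"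

primrec cost :: "('x, 'y, 'z) protocol \<Rightarrow> nat" where
  "cost (Answer z) = 0"
| "cost (Ask_A q P Q) = Suc (max (cost P) (cost Q))"
| "cost (Ask_B q P Q) = Suc (max (cost P) (cost Q))"

definition solves ::
  "('x, 'y, 'z) protocol \<Rightarrow> 'x set \<Rightarrow> 'y set \<Rightarrow> ('x \<Rightarrow> 'y \<Rightarrow> 'z \<Rightarrow> bool) \<Rightarrow> bool" where
  "solves P X Y R \<longleftrightarrow> (\<forall>x\<in>X. \<forall>y\<in>Y. R x y (run P x y))"

definition vertices :: "'a::euclidean_space set \<Rightarrow> 'a set" where
  "vertices S = {x. x extreme_point_of S}"

definition points :: "'a::euclidean_space set set \<Rightarrow> 'a set" where
  "points K = (\<Union>S\<in>K. vertices S)"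

definition nondegenerate :: "nat \<Rightarrow> (nat \<Rightarrow> 'a::euclidean_space) \<Rightarrow> bool" where
  "nondegenerate d v \<longleftrightarrow> inj_on v {..d} \<and> \<not> affine_dependent (v ` {..d})"

definition big_simplex :: "nat \<Rightarrow> (nat \<Rightarrow> 'a::euclidean_space) \<Rightarrow> 'a set" where
  "big_simplex d v = convex hull (v ` {..d})"

definition triangulates :: "'a::euclidean_space set set \<Rightarrow> 'a set \<Rightarrow> bool" where
  "triangulates K D \<longleftrightarrow> simplicial_complex K \<and> \<Union>K = D"

definition smallest_face :: "'a::euclidean_space set \<Rightarrow> 'a \<Rightarrow> 'a set" where
  "smallest_face D x = \<Inter>{F. F face_of D \<and> x \<in> F}"

definition sperner_at :: "nat \<Rightarrow> (nat \<Rightarrow> 'a::euclidean_space) \<Rightarrow> 'a \<Rightarrow> nat \<Rightarrow> bool" where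
  "sperner_at d v x i \<longleftrightarrow>
     i \<le> d \<and> (\<forall>j\<le>d. x = v j \<longrightarrow> i = j) \<and> v i \<in> vertices (smallest_face (big_simplex d v) x)"

definition sperner_coloring ::
  "nat \<Rightarrow> (nat \<Rightarrow> 'a::euclidean_space) \<Rightarrow> 'a set set \<Rightarrow> ('a \<Rightarrow> nat) \<Rightarrow> bool" where
  "sperner_coloring d v K c \<longleftrightarrow> (\<forall>x\<in>points K. sperner_at d v x (c x))"

text \<open>
  A coloring of a set of points is a partial map, its domain being the colored set.
\<close>

definition inputs :: "'a::euclidean_space set set \<Rightarrow> nat set \<Rightarrow> ('a \<rightharpoonup> nat) set" where
  "inputs K C = {c. dom c \<subseteq> points K \<and> ran c \<subseteq> C}"

text \<open>
  The combined coloring is left undefined at points colored by both players.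
\<close>

definition combine :: "('a \<rightharpoonup> nat) \<Rightarrow> ('a \<rightharpoonup> nat) \<Rightarrow> ('a \<rightharpoonup> nat)" where
  "combine cA cB x = (case (cA x, cB x) of
       (Some i, None) \<Rightarrow> Some i
     | (None, Some i) \<Rightarrow> Some i
     | _ \<Rightarrow> None)"

datatype 'a answer = Panchromatic "'a set" | Violation 'a

fun sperner_answer ::
  "nat \<Rightarrow> (nat \<Rightarrow> 'a::euclidean_space) \<Rightarrow> 'a set set \<Rightarrow> ('a \<rightharpoonup> nat) \<Rightarrow> ('a \<rightharpoonup> nat) \<Rightarrow> 'a answer \<Rightarrow> bool"
where
  "sperner_answer d v K cA cB (Panchromatic S) \<longleftrightarrow>
     S \<in> K \<and> int d simplex S \<and> combine cA cB ` vertices S = Some ` {..d}"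
| "sperner_answer d v K cA cB (Violation x) \<longleftrightarrow>
     x \<in> points K \<and>
     (x \<notin> dom cA \<union> dom cB \<or> x \<in> dom cA \<inter> dom cB \<or>
      (\<exists>i. combine cA cB x = Some i \<and> \<not> sperner_at d v x i))"

lemma no_violation_iff:
  assumes "cA \<in> inputs K {..<t}" "cB \<in> inputs K {t..d}"
  shows "(\<nexists>x. sperner_answer d v K cA cB (Violation x)) \<longleftrightarrow>
    dom cA \<union> dom cB = points K \<and> dom cA \<inter> dom cB = {} \<and>
    sperner_coloring d v K (\<lambda>x. the (combine cA cB x))"
    (is "?L \<longleftrightarrow> ?R")
proof
  assume ?L
  then have nv: "x \<notin> dom cA \<inter> dom cB" "x \<in> dom cA \<union> dom cB"
    "combine cA cB x = Some i \<Longrightarrow> sperner_at d v x i" if "x \<in> points K" for x i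
    using that sperner_answer.simps(2) by blast+
  have sub: "dom cA \<subseteq> points K" "dom cB \<subseteq> points K"
    using assms unfolding inputs_def by blast+
  have 1: "dom cA \<union> dom cB = points K" "dom cA \<inter> dom cB = {}"
    using nv(1,2) sub by blast+
  have "sperner_at d v x (the (combine cA cB x))" if x: "x \<in> points K" for x
  proof -
    have "x \<in> dom cA \<longleftrightarrow> x \<notin> dom cB" using 1 x by blast
    then obtain i where i: "combine cA cB x = Some i"
      by (cases "cA x"; cases "cB x") (auto simp: combine_def)
    with nv(3)[OF x i] show ?thesis by simp
  qed
  with 1 show ?R by (simp add: sperner_coloring_def)
next
  assume ?R
  then have R: "dom cA \<union> dom cB = points K" "dom cA \<inter> dom cB = {}"
    "\<And>x. x \<in> points K \<Longrightarrow> sperner_at d v x (the (combine cA cB x))"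
    unfolding sperner_coloring_def by blast+
  show ?L
    unfolding sperner_answer.simps using R by (metis empty_iff option.sel)
qed

definition solves_Sp ::
  "nat \<Rightarrow> nat \<Rightarrow> (nat \<Rightarrow> 'a::euclidean_space) \<Rightarrow> 'a set set \<Rightarrow>
   ('a \<rightharpoonup> nat, 'a \<rightharpoonup> nat, 'a answer) protocol \<Rightarrow> bool" where
  "solves_Sp t d v K P \<longleftrightarrow>
     solves P (inputs K {..<t}) (inputs K {t..d}) (sperner_answer d v K)"

end

theory Submission
  imports Defs "HOL-Library.Log_Nat"
begin

text \<open>
  For \<open>d = Suc t\<close>, \<open>A\<close> knows the colors below \<open>t\<close> and \<open>B\<close> knows the colors \<open>t\<close> and \<open>Suc t\<close>.
  Player \<open>A\<close> joins two points outside \<open>S\<^sub>A\<close> by an edge if they are the two remaining vertices of a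
  \<open>d\<close>-simplex showing all of \<open>A\<close>'s colors; such a simplex is panchromatic as soon as \<open>B\<close> colors
  the two points differently. By Sperner's lemma this graph contains a path from the facet opposite
  to \<open>v d\<close>, where \<open>B\<close> may only use \<open>t\<close>, to the facet opposite to \<open>v t\<close>, where \<open>B\<close> may only use \<open>d\<close>.
  Binary search for a color change along the path takes \<open>O(log n)\<close> rounds, in each of which \<open>A\<close>
  names a point with \<open>O(log n)\<close> bits and \<open>B\<close> answers with one bit.
\<close>

subsection \<open>Protocols under a promise\<close>

text \<open>
  The promise \<open>D\<close> records what has become known about the inputs at the current node.
\<close>

definition solvable_within ::
  "('x \<Rightarrow> 'y \<Rightarrow> 'z \<Rightarrow> bool) \<Rightarrow> nat \<Rightarrow> ('x \<Rightarrow> 'y \<Rightarrow> bool) \<Rightarrow> bool" where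
  "solvable_within R k D \<longleftrightarrow> (\<exists>P. cost P \<le> k \<and> (\<forall>x y. D x y \<longrightarrow> R x y (run P x y)))"

lemma solvable_within_mono:
  assumes "solvable_within R k D" "k \<le> k'" "\<And>x y. D' x y \<Longrightarrow> D x y"
  shows "solvable_within R k' D'"
  using assms unfolding solvable_within_def by (meson le_trans)

lemma solvable_within_answer:
  assumes "\<And>x y. D x y \<Longrightarrow> R x y z"
  shows "solvable_within R k D"
  unfolding solvable_within_def using assms by (intro exI[of _ "Answer z"]) auto

primrec swap_players :: "('x, 'y, 'z) protocol \<Rightarrow> ('y, 'x, 'z) protocol" where
  "swap_players (Answer z) = Answer z"
| "swap_players (Ask_A q P Q) = Ask_B q (swap_players P) (swap_players Q)"
| "swap_players (Ask_B q P Q) = Ask_A q (swap_players P) (swap_players Q)"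

lemma run_swap_players: "run (swap_players P) y x = run P x y"
  by (induction P) simp_all

lemma cost_swap_players: "cost (swap_players P) = cost P"
  by (induction P) simp_all

lemma solvable_within_swap:
  assumes "solvable_within (\<lambda>y x. R x y) k (\<lambda>y x. D x y)"
  shows "solvable_within R k D"
  using assms unfolding solvable_within_def by (metis cost_swap_players run_swap_players)

lemma solvable_within_ask_A:
  assumes "solvable_within R k (\<lambda>x y. D x y \<and> q x)" "solvable_within R k (\<lambda>x y. D x y \<and> \<not> q x)"
  shows "solvable_within R (Suc k) D"
proof -
  obtain P Q where "cost P \<le> k" "\<forall>x y. D x y \<and> q x \<longrightarrow> R x y (run P x y)"
    "cost Q \<le> k" "\<forall>x y. D x y \<and> \<not> q x \<longrightarrow> R x y (run Q x y)"
    using assms unfolding solvable_within_def by blast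
  then show ?thesis
    unfolding solvable_within_def by (intro exI[of _ "Ask_A q P Q"]) auto
qed

lemma solvable_within_ask_B:
  assumes "solvable_within R k (\<lambda>x y. D x y \<and> q y)" "solvable_within R k (\<lambda>x y. D x y \<and> \<not> q y)"
  shows "solvable_within R (Suc k) D"
  by (intro solvable_within_swap[of R] solvable_within_ask_A[where q = q])
    (use assms in \<open>auto intro: solvable_within_swap\<close>)

lemma solvable_within_announce_A:
  assumes "finite Z" "card Z \<le> 2 ^ k" "\<And>x y. D x y \<Longrightarrow> e x \<in> Z"
    and "\<And>z. z \<in> Z \<Longrightarrow> solvable_within R m (\<lambda>x y. D x y \<and> e x = z)"
  shows "solvable_within R (k + m) D"
  using assms
proof (induction k arbitrary: Z D)
  case 0
  show ?case
  proof (cases "Z = {}")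
    case True
    with "0.prems"(3) show ?thesis by (intro solvable_within_answer) auto
  next
    case False
    then obtain z where "z \<in> Z" by blast
    moreover from this "0.prems"(1-3) have "e x = z" if "D x y" for x y
      using that by (auto simp: card_le_Suc0_iff_eq)
    ultimately show ?thesis
      using "0.prems"(4) by (auto intro: solvable_within_mono)
  qed
next
  case (Suc k)
  obtain H where H: "H \<subseteq> Z" "card H = card Z div 2"
    by (metis div_le_dividend obtain_subset_with_card_n)
  with Suc.prems(1,2) have half: "finite H" "card H \<le> 2 ^ k" "finite (Z - H)" "card (Z - H) \<le> 2 ^ k"
    by (auto simp: card_Diff_subset finite_subset)
  have "solvable_within R (k + m) (\<lambda>x y. D x y \<and> e x \<in> H)"
    by (rule Suc.IH[OF half(1,2)]) (use Suc.prems(4) H(1) in \<open>auto intro: solvable_within_mono\<close>)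
  moreover have "solvable_within R (k + m) (\<lambda>x y. D x y \<and> e x \<notin> H)"
    by (rule Suc.IH[OF half(3,4)]) (use Suc.prems(3,4) in \<open>auto intro: solvable_within_mono\<close>)
  ultimately show ?case
    using solvable_within_ask_A[where q = "\<lambda>x. e x \<in> H"] by simp
qed

lemma solvable_within_check_A:
  assumes "finite Z" "card Z \<le> 2 ^ k"
    and witness: "\<And>x y z. D x y \<Longrightarrow> z \<in> Z \<Longrightarrow> W x z \<Longrightarrow> R x y (ans z)"
    and no_witness: "solvable_within R m (\<lambda>x y. D x y \<and> (\<forall>z\<in>Z. \<not> W x z))"
  shows "solvable_within R (Suc (k + m)) D"
proof (rule solvable_within_ask_A[where q = "\<lambda>x. \<exists>z\<in>Z. W x z"])
  define e where "e x = (SOME z. z \<in> Z \<and> W x z)" for x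
  have e: "e x \<in> Z" "W x (e x)" if "\<exists>z\<in>Z. W x z" for x
    using that someI_ex[of "\<lambda>z. z \<in> Z \<and> W x z"] unfolding e_def by blast+
  show "solvable_within R (k + m) (\<lambda>x y. D x y \<and> (\<exists>z\<in>Z. W x z))"
  proof (rule solvable_within_announce_A[where e = e, OF assms(1,2)])
    fix z
    show "solvable_within R m (\<lambda>x y. (D x y \<and> (\<exists>z\<in>Z. W x z)) \<and> e x = z)"
      using witness e by (intro solvable_within_answer[where z = "ans z"]) blast
  qed (use e in blast)
  show "solvable_within R (k + m) (\<lambda>x y. D x y \<and> \<not> (\<exists>z\<in>Z. W x z))"
    using no_witness by (rule solvable_within_mono) auto
qed

lemma solvable_within_check_B:
  assumes "finite Z" "card Z \<le> 2 ^ k"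
    and "\<And>x y z. D x y \<Longrightarrow> z \<in> Z \<Longrightarrow> W y z \<Longrightarrow> R x y (ans z)"
    and "solvable_within R m (\<lambda>x y. D x y \<and> (\<forall>z\<in>Z. \<not> W y z))"
  shows "solvable_within R (Suc (k + m)) D"
  by (intro solvable_within_swap[of R]
      solvable_within_check_A[where W = W and ans = ans, OF assms(1,2)])
    (use assms(3,4) in \<open>auto intro: solvable_within_swap\<close>)

lemma solvable_within_query:
  assumes "finite Z" "card Z \<le> 2 ^ k" "\<And>x y. D x y \<Longrightarrow> e x \<in> Z"
    and "\<And>z. z \<in> Z \<Longrightarrow> solvable_within R m (\<lambda>x y. D x y \<and> e x = z \<and> q y z)"
    and "\<And>z. z \<in> Z \<Longrightarrow> solvable_within R m (\<lambda>x y. D x y \<and> e x = z \<and> \<not> q y z)"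
  shows "solvable_within R (k + Suc m) D"
proof (rule solvable_within_announce_A[where e = e, OF assms(1-3)])
  fix z assume "z \<in> Z"
  with assms(4,5) show "solvable_within R (Suc m) (\<lambda>x y. D x y \<and> e x = z)"
    by (intro solvable_within_ask_B[where q = "\<lambda>y. q y z"]) simp_all
qed

lemma solvable_within_binary_search:
  assumes Z: "finite Z" "card Z \<le> 2 ^ k" and mem: "\<And>x y i. D x y \<Longrightarrow> i \<le> N \<Longrightarrow> f x i \<in> Z"
    and change: "\<And>i. i < N \<Longrightarrow>
      solvable_within R m (\<lambda>x y. D x y \<and> q y (f x i) \<and> \<not> q y (f x (Suc i)))"
    and "j + 2 ^ r \<le> N"
  shows "solvable_within R (r * Suc k + m)
    (\<lambda>x y. D x y \<and> q y (f x j) \<and> \<not> q y (f x (j + 2 ^ r)))"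
  using \<open>j + 2 ^ r \<le> N\<close>
proof (induction r arbitrary: j)
  case 0
  then show ?case using change[of j] by simp
next
  case (Suc r)
  let ?D = "\<lambda>x y. D x y \<and> q y (f x j) \<and> \<not> q y (f x (j + 2 ^ Suc r))"
  have "solvable_within R (k + Suc (r * Suc k + m)) ?D"
  proof (rule solvable_within_query[where e = "\<lambda>x. f x (j + 2 ^ r)" and q = q, OF Z])
    fix z
    show "solvable_within R (r * Suc k + m) (\<lambda>x y. ?D x y \<and> f x (j + 2 ^ r) = z \<and> q y z)"
      by (rule solvable_within_mono[OF Suc.IH[of "j + 2 ^ r"]])
        (use Suc.prems in \<open>auto simp: mult_2 add.assoc\<close>)
    show "solvable_within R (r * Suc k + m) (\<lambda>x y. ?D x y \<and> f x (j + 2 ^ r) = z \<and> \<not> q y z)"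
      by (rule solvable_within_mono[OF Suc.IH[of j]]) (use Suc.prems in auto)
  qed (use mem Suc.prems in auto)
  then show ?case by (simp add: algebra_simps)
qed

subsection \<open>Vertices of simplicial complexes\<close>

lemma vertices_subset: "vertices S \<subseteq> S"
  by (auto simp: vertices_def extreme_point_of_def)

lemma vertices_convex_hull_affine_independent:
  fixes C :: "'a::euclidean_space set"
  assumes "\<not> affine_dependent C"
  shows "vertices (convex hull C) = C"
  using assms by (auto simp: vertices_def extreme_point_of_convex_hull_affine_independent)

lemma vertices_face_of:
  assumes "F face_of S"
  shows "vertices F \<subseteq> vertices S"
  using extreme_point_of_face[OF assms] by (auto simp: vertices_def)

lemma simplex_vertices:
  fixes S :: "'a::euclidean_space set"
  assumes "n simplex S"
  shows "finite (vertices S)" "int (card (vertices S)) = n + 1" "S = convex hull (vertices S)"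
proof -
  obtain C where C: "finite C" "\<not> affine_dependent C" "int (card C) = n + 1" "S = convex hull C"
    using assms unfolding simplex by blast
  then have "vertices S = C" by (simp add: vertices_convex_hull_affine_independent)
  with C show "finite (vertices S)" "int (card (vertices S)) = n + 1" "S = convex hull (vertices S)"
    by simp_all
qed

lemma finite_points:
  fixes K :: "'a::euclidean_space set set"
  assumes "simplicial_complex K"
  shows "finite (points K)"
proof -
  have "finite K" "\<And>S. S \<in> K \<Longrightarrow> \<exists>n. n simplex S"
    using assms by (auto simp: simplicial_complex_def)
  then show ?thesis
    unfolding points_def using simplex_vertices(1) by (metis finite_UN)
qed

lemma card_simplices_le:
  fixes K :: "'a::euclidean_space set set"
  assumes "simplicial_complex K"
  shows "card {S \<in> K. int d simplex S} \<le> card (points K) ^ Suc d"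
proof -
  let ?simplices = "{S \<in> K. int d simplex S}"
  let ?vertex_sets = "{V. V \<subseteq> points K \<and> card V = Suc d}"
  have fin: "finite (points K)" by (rule finite_points[OF assms])
  have "inj_on vertices ?simplices"
    using simplex_vertices(3) by (metis (mono_tags, lifting) inj_onI mem_Collect_eq)
  moreover have "vertices ` ?simplices \<subseteq> ?vertex_sets"
    using simplex_vertices(2) by (fastforce simp: points_def)
  ultimately have "card ?simplices \<le> card ?vertex_sets" using fin by (intro card_inj_on_le) auto
  also have "\<dots> = card (points K) choose Suc d" by (rule n_subsets[OF fin])
  also have "\<dots> \<le> card (points K) ^ Suc d"
    by (cases "Suc d \<le> card (points K)") (simp_all only: binomial_le_pow binomial_eq_0 not_le le0)
  finally show ?thesis .
qed

lemma simplicial_complex_rel_interior_cover: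
  fixes K :: "'a::euclidean_space set set"
  assumes K: "simplicial_complex K" and x: "x \<in> \<Union>K"
  obtains S where "S \<in> K" "x \<in> rel_interior S"
proof -
  have "finite {S \<in> K. x \<in> S}" using K by (simp add: simplicial_complex_def)
  moreover have "{S \<in> K. x \<in> S} \<noteq> {}" using x by blast
  ultimately obtain S where S: "S \<in> K" "x \<in> S"
    and minimal: "\<And>T. T \<in> K \<Longrightarrow> x \<in> T \<Longrightarrow> T \<subseteq> S \<Longrightarrow> T = S"
    using finite_has_minimal[of "{S \<in> K. x \<in> S}"] by blast
  have "x \<in> rel_interior S"
  proof (rule ccontr)
    assume "x \<notin> rel_interior S"
    moreover have polyhedron: "polyhedron S"
      using K S(1) simplex_imp_polyhedron unfolding simplicial_complex_def by blast
    ultimately obtain F where F: "F facet_of S" "x \<in> F"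
      using S(2) rel_boundary_of_polyhedron[OF polyhedron] by blast
    then have "F \<in> K" "F \<subseteq> S"
      using K S(1) unfolding simplicial_complex_def
      by (meson facet_of_imp_face_of facet_of_imp_subset)+
    with minimal F have "S facet_of S" by blast
    then show False using facet_of_irrefl by blast
  qed
  with S that show ?thesis by blast
qed

lemma simplicial_complex_vertices_subset:
  fixes K :: "'a::euclidean_space set set"
  assumes K: "simplicial_complex K" and S: "S \<in> K" "T \<in> K" and x: "x \<in> rel_interior S" "x \<in> T"
  shows "vertices S \<subseteq> vertices T"
proof -
  have faces: "S \<inter> T face_of S" "T \<inter> S face_of T"
    using K S unfolding simplicial_complex_def by blast+
  have "S \<inter> T = S"
    using face_of_disjoint_rel_interior[OF faces(1)] x rel_interior_subset by blast
  with faces(2) show ?thesis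
    by (metis inf_commute vertices_face_of)
qed

definition missing_color :: "'a::euclidean_space set set \<Rightarrow> ('a \<Rightarrow> nat) \<Rightarrow> nat \<Rightarrow> 'a set" where
  "missing_color K c i = \<Union>{S \<in> K. i \<notin> c ` vertices S}"

lemma closed_missing_color:
  assumes "simplicial_complex K"
  shows "closed (missing_color K c i)"
  unfolding missing_color_def using assms
  by (intro closed_Union) (auto simp: simplicial_complex_def dest: closed_simplex)

lemma exists_color_not_missing:
  assumes K: "simplicial_complex K" and x: "x \<in> \<Union>K"
  obtains p where "p \<in> points K" "x \<notin> missing_color K c (c p)"
proof -
  obtain S where S: "S \<in> K" "x \<in> rel_interior S"
    using simplicial_complex_rel_interior_cover[OF K x] by blast
  then have "S \<noteq> {}" using rel_interior_subset by blast
  moreover obtain n where "n simplex S" using K S(1) by (auto simp: simplicial_complex_def)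
  ultimately obtain p where p: "p \<in> vertices S"
    using simplex_vertices(3) by (metis convex_hull_empty ex_in_conv)
  then have "x \<notin> missing_color K c (c p)"
    using simplicial_complex_vertices_subset[OF K S(1) _ S(2)] unfolding missing_color_def by blast
  with p S(1) that show ?thesis by (auto simp: points_def)
qed

subsection \<open>Sperner's lemma\<close>

lemma normalized_sum_mem_convex_hull:
  fixes v :: "'i \<Rightarrow> 'a::real_vector"
  assumes "finite I" and nonneg: "\<And>i. i \<in> I \<Longrightarrow> g i \<ge> 0" and pos: "sum g I > 0"
  shows "(\<Sum>i\<in>I. (g i / sum g I) *\<^sub>R v i) \<in> convex hull (v ` {i \<in> I. g i \<noteq> 0})"
proof -
  let ?J = "{i \<in> I. g i \<noteq> 0}"
  have "(\<Sum>i\<in>?J. g i / sum g I) = (\<Sum>i\<in>I. g i / sum g I)"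
    using \<open>finite I\<close> by (intro sum.mono_neutral_left) auto
  also have "\<dots> = 1" using pos by (simp flip: sum_divide_distrib)
  finally have "(\<Sum>i\<in>?J. (g i / sum g I) *\<^sub>R v i) \<in> convex hull (v ` ?J)"
    using \<open>finite I\<close> nonneg pos by (intro convex_sum) (auto simp: hull_inc)
  moreover have "(\<Sum>i\<in>I. (g i / sum g I) *\<^sub>R v i) = (\<Sum>i\<in>?J. (g i / sum g I) *\<^sub>R v i)"
    using \<open>finite I\<close> by (intro sum.mono_neutral_right) auto
  ultimately show ?thesis by simp
qed

text \<open>
  Without a common point, weighting every \<open>v i\<close> with the normalized distance of \<open>x\<close> to \<open>F i\<close> maps
  the hull continuously to itself. A fixed point lies in the hull of those \<open>v i\<close> for which it avoids
  \<open>F i\<close>.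
\<close>

theorem Knaster_Kuratowski_Mazurkiewicz:
  fixes v :: "'i \<Rightarrow> 'a::euclidean_space"
  assumes I: "finite I" "I \<noteq> {}" and closed: "\<And>i. i \<in> I \<Longrightarrow> closed (F i)"
    and cover: "\<And>J. J \<subseteq> I \<Longrightarrow> convex hull (v ` J) \<subseteq> (\<Union>j\<in>J. F j)"
  shows "\<exists>x \<in> convex hull (v ` I). \<forall>i\<in>I. x \<in> F i"
proof (rule ccontr)
  let ?hull = "convex hull (v ` I)"
  assume "\<not> (\<exists>x\<in>?hull. \<forall>i\<in>I. x \<in> F i)"
  then have no_common_point: "\<exists>i\<in>I. x \<notin> F i" if "x \<in> ?hull" for x using that by blast
  define g where "g x i = infdist x (F i)" for x i
  define h where "h x = (\<Sum>i\<in>I. (g x i / sum (g x) I) *\<^sub>R v i)" for x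
  have g_nonneg: "g x i \<ge> 0" for x i by (simp add: g_def infdist_nonneg)
  have g_pos: "g x i > 0" if "i \<in> I" "x \<notin> F i" for x i
    using infdist_pos_not_in_closed[OF closed] cover[of "{i}"] that by (auto simp: g_def)
  have sum_pos: "sum (g x) I > 0" if "x \<in> ?hull" for x
    using no_common_point[OF that] I(1) g_nonneg g_pos by (metis sum_pos2)
  have h_mem: "h x \<in> convex hull (v ` {i \<in> I. g x i \<noteq> 0})" if "x \<in> ?hull" for x
    unfolding h_def using I(1) g_nonneg sum_pos[OF that] by (rule normalized_sum_mem_convex_hull)
  have "compact ?hull" "convex ?hull" "?hull \<noteq> {}"
    using I by (simp_all add: finite_imp_compact_convex_hull)
  moreover have "continuous_on ?hull h"
    unfolding h_def g_def using sum_pos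
    by (intro continuous_intros) (auto simp: g_def less_le)
  moreover have "convex hull (v ` {i \<in> I. g x i \<noteq> 0}) \<subseteq> ?hull" for x
    by (intro hull_mono) auto
  then have "h \<in> ?hull \<rightarrow> ?hull" using h_mem by blast
  ultimately obtain x where x: "x \<in> ?hull" "h x = x"
    by (rule brouwer)
  then have "x \<in> (\<Union>j\<in>{i \<in> I. g x i \<noteq> 0}. F j)"
    using h_mem[OF x(1)] cover[of "{i \<in> I. g x i \<noteq> 0}"] by auto
  then show False by (auto simp: g_def)
qed

locale nondegenerate_simplex =
  fixes d :: nat and v :: "nat \<Rightarrow> 'a::euclidean_space"
  assumes nondegenerate: "nondegenerate d v"
begin

definition opposite_facet :: "nat \<Rightarrow> 'a set" where
  "opposite_facet i = convex hull (v ` ({..d} - {i}))"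

lemma face_of_big_simplex_iff:
  "F face_of big_simplex d v \<longleftrightarrow> (\<exists>C \<subseteq> v ` {..d}. F = convex hull C)"
  using nondegenerate unfolding nondegenerate_def big_simplex_def
  by (simp add: face_of_convex_hull_affine_independent)

lemma opposite_facet_face_of: "opposite_facet i face_of big_simplex d v"
  unfolding face_of_big_simplex_iff opposite_facet_def by (intro exI[of _ "v ` ({..d} - {i})"]) auto

lemma image_vertices_diff:
  assumes "i \<le> d"
  shows "v ` ({..d} - {i}) = v ` {..d} - {v i}"
  using assms nondegenerate by (auto simp: nondegenerate_def inj_on_def)

lemma notin_opposite_facet:
  assumes "i \<le> d"
  shows "v i \<notin> opposite_facet i"
proof
  assume "v i \<in> opposite_facet i"
  then have "v i \<in> affine hull (v ` {..d} - {v i})"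
    using convex_hull_subset_affine_hull image_vertices_diff[OF assms]
    unfolding opposite_facet_def by fastforce
  then have "affine_dependent (v ` {..d})"
    using assms unfolding affine_dependent_def by blast
  with nondegenerate show False by (simp add: nondegenerate_def)
qed

lemma vertex_of_smallest_face_iff:
  assumes "i \<le> d" and x: "x \<in> big_simplex d v"
  shows "v i \<in> vertices (smallest_face (big_simplex d v) x) \<longleftrightarrow> x \<notin> opposite_facet i"
proof
  assume "v i \<in> vertices (smallest_face (big_simplex d v) x)"
  then have "v i \<in> smallest_face (big_simplex d v) x" using vertices_subset by blast
  then show "x \<notin> opposite_facet i"
    using opposite_facet_face_of notin_opposite_facet[OF \<open>i \<le> d\<close>]
    unfolding smallest_face_def by blast
next
  let ?F = "smallest_face (big_simplex d v) x"
  assume notin: "x \<notin> opposite_facet i"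
  have "big_simplex d v face_of big_simplex d v"
    by (simp add: big_simplex_def face_of_refl)
  with x have "?F face_of big_simplex d v" "x \<in> ?F"
    unfolding smallest_face_def by (auto intro: face_of_Inter)
  then obtain C where C: "C \<subseteq> v ` {..d}" "?F = convex hull C" "x \<in> convex hull C"
    unfolding face_of_big_simplex_iff by auto
  have "v i \<in> C"
  proof (rule ccontr)
    assume "v i \<notin> C"
    with C(1) have "C \<subseteq> v ` ({..d} - {i})" by blast
    with C(3) notin show False unfolding opposite_facet_def using hull_mono by blast
  qed
  moreover have "\<not> affine_dependent C"
    using nondegenerate affine_dependent_subset[OF _ C(1)] by (auto simp: nondegenerate_def)
  ultimately show "v i \<in> vertices ?F"
    unfolding C(2) by (simp add: vertices_convex_hull_affine_independent)
qed

lemma sperner_at_iff: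
  assumes "x \<in> big_simplex d v"
  shows "sperner_at d v x i \<longleftrightarrow> i \<le> d \<and> x \<notin> opposite_facet i"
proof -
  have "v j \<in> opposite_facet i" if "j \<le> d" "j \<noteq> i" for j
    using that by (auto simp: opposite_facet_def hull_inc)
  then show ?thesis
    using vertex_of_smallest_face_iff[OF _ assms] unfolding sperner_at_def by metis
qed

end

locale triangulated_simplex = nondegenerate_simplex d v
  for d :: nat and v :: "nat \<Rightarrow> 'a::euclidean_space" +
  fixes K :: "'a set set"
  assumes triangulates: "triangulates K (big_simplex d v)"
begin

lemma simplicial_complex: "simplicial_complex K" and Union_simplices: "\<Union>K = big_simplex d v"
  using triangulates by (simp_all add: triangulates_def)

lemma points_subset: "points K \<subseteq> big_simplex d v"
  using Union_simplices vertices_subset unfolding points_def by blast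

lemma opposite_facet_subset_missing_color:
  assumes "sperner_coloring d v K c"
  shows "opposite_facet i \<subseteq> missing_color K c i"
proof
  fix x assume x: "x \<in> opposite_facet i"
  then have "x \<in> \<Union>K" using opposite_facet_face_of Union_simplices face_of_imp_subset by blast
  then obtain S where S: "S \<in> K" "x \<in> rel_interior S"
    using simplicial_complex_rel_interior_cover[OF simplicial_complex] by blast
  then have "S \<subseteq> opposite_facet i"
    using Union_simplices x by (intro subset_of_face_of[OF opposite_facet_face_of]) auto
  moreover have "p \<in> points K" if "p \<in> vertices S" for p
    using that S(1) by (auto simp: points_def)
  ultimately have "i \<notin> c ` vertices S"
    using assms sperner_at_iff points_subset vertices_subset unfolding sperner_coloring_def by blast
  with S rel_interior_subset show "x \<in> missing_color K c i"
    unfolding missing_color_def by blast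
qed

lemma panchromatic_imp_simplex:
  assumes "S \<in> K" "c ` vertices S = {..d}"
  shows "int d simplex S"
proof -
  obtain n where n: "n simplex S"
    using simplicial_complex assms(1) by (auto simp: simplicial_complex_def)
  have "int d + 1 \<le> n + 1"
    using card_image_le[OF simplex_vertices(1)[OF n], of c] simplex_vertices(2)[OF n] assms(2)
    by simp
  moreover have "n \<le> d"
  proof -
    have "n = aff_dim S" using aff_dim_simplex[OF n] by simp
    also have "\<dots> \<le> aff_dim (big_simplex d v)"
      using assms(1) Union_simplices by (intro aff_dim_subset) blast
    also have "\<dots> = int (card (v ` {..d})) - 1"
      using nondegenerate
      by (simp add: big_simplex_def nondegenerate_def aff_dim_convex_hull
          aff_dim_affine_independent)
    also have "\<dots> = d" using nondegenerate by (simp add: nondegenerate_def card_image)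
    finally show ?thesis .
  qed
  ultimately show ?thesis using n by simp
qed

definition color_depth :: "('a \<Rightarrow> nat) \<Rightarrow> nat \<Rightarrow> 'a \<Rightarrow> real" where
  "color_depth c i x = infdist x (missing_color K c i)"

lemma color_depth_eq_0:
  assumes "x \<in> missing_color K c i"
  shows "color_depth c i x = 0"
  using assms by (simp add: color_depth_def)

lemma color_depth_pos:
  assumes "missing_color K c i \<noteq> {}" "x \<notin> missing_color K c i"
  shows "color_depth c i x > 0"
  unfolding color_depth_def
  by (intro infdist_pos_not_in_closed closed_missing_color[OF simplicial_complex] assms)

lemma deepest_color_on_face:
  assumes coloring: "sperner_coloring d v K c" and J: "J \<subseteq> {..d}" and x: "x \<in> convex hull (v ` J)"
  shows "\<exists>i\<in>J. \<forall>j. color_depth c j x \<le> color_depth c i x"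
proof -
  have "finite J" "J \<noteq> {}" using J x finite_subset by auto
  then obtain i where i: "i \<in> J" "\<And>j. j \<in> J \<Longrightarrow> color_depth c j x \<le> color_depth c i x"
    using Max_in[of "(\<lambda>j. color_depth c j x) ` J"] Max_ge[of "(\<lambda>j. color_depth c j x) ` J"]
    by fastforce
  have "color_depth c j x = 0" if "j \<notin> J" for j
  proof -
    have "convex hull (v ` J) \<subseteq> opposite_facet j"
      unfolding opposite_facet_def using J that by (intro hull_mono) auto
    then show ?thesis
      using x opposite_facet_subset_missing_color[OF coloring] by (intro color_depth_eq_0) blast
  qed
  then have "color_depth c j x \<le> color_depth c i x" for j
    using i(2) by (cases "j \<in> J") (simp_all add: color_depth_def infdist_nonneg)
  with i(1) show ?thesis by blast
qed

text \<open>
  Apply the KKM theorem to the regions in which color \<open>i\<close> is deepest: at a common point all depths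
  agree, hence are positive.
\<close>

theorem sperner_panchromatic:
  assumes "d \<ge> 1" and coloring: "sperner_coloring d v K c"
  obtains S where "S \<in> K" "int d simplex S" "c ` vertices S = {..d}"
proof -
  define F where "F i = (\<Inter>j. {x. color_depth c j x \<le> color_depth c i x})" for i
  have "closed (F i)" for i
    unfolding F_def color_depth_def
    by (intro closed_INT ballI closed_Collect_le continuous_intros)
  moreover have "convex hull (v ` J) \<subseteq> (\<Union>j\<in>J. F j)" if J: "J \<subseteq> {..d}" for J
    using deepest_color_on_face[OF coloring J] by (auto simp: F_def)
  ultimately obtain x where "x \<in> convex hull (v ` {..d})" and x: "\<forall>i\<in>{..d}. x \<in> F i"
    using Knaster_Kuratowski_Mazurkiewicz[of "{..d}" F v] by auto
  then have "x \<in> \<Union>K" using Union_simplices by (simp add: big_simplex_def)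
  then obtain S where S: "S \<in> K" "x \<in> S" by blast
  obtain p where p: "p \<in> points K" "x \<notin> missing_color K c (c p)"
    using exists_color_not_missing[OF simplicial_complex \<open>x \<in> \<Union>K\<close>] by blast
  have "(if c p = 0 then 1 else 0) \<in> {..d} - {c p}" using \<open>d \<ge> 1\<close> by simp
  then have "{..d} - {c p} \<noteq> {}" by blast
  then have "missing_color K c (c p) \<noteq> {}"
    using opposite_facet_subset_missing_color[OF coloring, of "c p"]
    by (auto simp: opposite_facet_def)
  with p(2) have "color_depth c (c p) x > 0" by (simp add: color_depth_pos)
  moreover have "color_depth c (c p) x \<le> color_depth c i x" if "i \<le> d" for i
    using x that by (simp add: F_def)
  ultimately have "x \<notin> missing_color K c i" if "i \<le> d" for i
    using that color_depth_eq_0 by (metis not_le)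
  then have "{..d} \<subseteq> c ` vertices S"
    using S unfolding missing_color_def by blast
  moreover have "c ` vertices S \<subseteq> {..d}"
    using coloring S(1) by (auto simp: sperner_coloring_def sperner_at_def points_def)
  ultimately have "c ` vertices S = {..d}" by blast
  with S(1) panchromatic_imp_simplex that show ?thesis by blast
qed

end


subsection \<open>The graph of player A\<close>

lemma rtrancl_imp_relpow_reflcl:
  assumes "finite E" "card E \<le> N" "(a, b) \<in> E\<^sup>*"
  shows "(a, b) \<in> (E\<^sup>=) ^^ N"
proof -
  obtain n where n: "n \<le> card E" "(a, b) \<in> E ^^ n"
    using assms(1,3) by (auto simp: rtrancl_finite_eq_relpow)
  then obtain f where f: "f 0 = a" "f n = b" "\<forall>i<n. (f i, f (Suc i)) \<in> E"
    unfolding relpow_fun_conv by blast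
  have "(f (min i n), f (min (Suc i) n)) \<in> E\<^sup>=" for i
    using f(3) by (cases "i < n") (auto simp: min_def)
  with f(1,2) n(1) assms(2) show ?thesis
    unfolding relpow_fun_conv by (intro exI[of _ "\<lambda>i. f (min i n)"]) (simp add: min_absorb2)
qed

locale concatenated_sperner = triangulated_simplex "Suc t" v K
  for t :: nat and v :: "nat \<Rightarrow> 'a::euclidean_space" and K :: "'a set set"
begin

definition almost_panchromatic :: "('a \<rightharpoonup> nat) \<Rightarrow> 'a \<Rightarrow> 'a \<Rightarrow> 'a set \<Rightarrow> bool" where
  "almost_panchromatic x p q S \<longleftrightarrow>
     S \<in> K \<and> int (Suc t) simplex S \<and> p \<in> vertices S \<and> q \<in> vertices S \<and>
     x p = None \<and> x q = None \<and> x ` (vertices S - {p, q}) = Some ` {..<t}"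

definition almost_panchromatic_edges :: "('a \<rightharpoonup> nat) \<Rightarrow> ('a \<times> 'a) set" where
  "almost_panchromatic_edges x = {(p, q). \<exists>S. almost_panchromatic x p q S}"

definition partial_sperner_coloring :: "('a \<rightharpoonup> nat) \<Rightarrow> bool" where
  "partial_sperner_coloring x \<longleftrightarrow> (\<forall>p\<in>dom x. sperner_at (Suc t) v p (the (x p)))"

definition complete_coloring :: "('a \<rightharpoonup> nat) \<Rightarrow> 'a set \<Rightarrow> 'a \<Rightarrow> nat" where
  "complete_coloring x X p = (case x p of Some i \<Rightarrow> i | None \<Rightarrow> if p \<in> X then t else Suc t)"

lemma almost_panchromatic_edges_subset:
  "almost_panchromatic_edges x \<subseteq> {p \<in> points K. x p = None} \<times> {p \<in> points K. x p = None}"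
  by (auto simp: almost_panchromatic_edges_def almost_panchromatic_def points_def)

lemma almost_panchromatic_eq_None_iff:
  assumes S: "almost_panchromatic x p q S" and w: "w \<in> vertices S"
  shows "x w = None \<longleftrightarrow> w \<in> {p, q}"
proof (cases "w \<in> {p, q}")
  case True
  with S show ?thesis by (auto simp: almost_panchromatic_def)
next
  case False
  with w have "x w \<in> x ` (vertices S - {p, q})" by blast
  with S have "x w \<in> Some ` {..<t}" by (simp add: almost_panchromatic_def)
  with False show ?thesis by auto
qed

lemma sperner_coloring_complete_coloring:
  assumes x: "partial_sperner_coloring x"
    and "\<And>p. p \<in> points K \<Longrightarrow> x p = None \<Longrightarrow> p \<in> X \<Longrightarrow> p \<notin> opposite_facet t"
    and "\<And>p. p \<in> points K \<Longrightarrow> x p = None \<Longrightarrow> p \<notin> X \<Longrightarrow> p \<notin> opposite_facet (Suc t)"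
  shows "sperner_coloring (Suc t) v K (complete_coloring x X)"
  unfolding sperner_coloring_def
proof
  fix p assume p: "p \<in> points K"
  then have "p \<in> big_simplex (Suc t) v" using points_subset by blast
  then show "sperner_at (Suc t) v p (complete_coloring x X p)"
  proof (cases "x p")
    case None
    with p \<open>p \<in> big_simplex (Suc t) v\<close> assms(2,3)[of p] show ?thesis
      by (simp add: complete_coloring_def sperner_at_iff)
  next
    case (Some i)
    with x show ?thesis
      by (force simp: complete_coloring_def partial_sperner_coloring_def)
  qed
qed

lemma panchromatic_complete_coloring:
  assumes x: "ran x \<subseteq> {..<t}"
    and S: "S \<in> K" "int (Suc t) simplex S" "complete_coloring x X ` vertices S = {..Suc t}"
  obtains p q where "p \<in> X" "q \<notin> X" "(p, q) \<in> almost_panchromatic_edges x"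
proof -
  let ?c = "complete_coloring x X"
  have old: "x p = Some (?c p)" if "?c p < t" for p
    using that by (auto simp: complete_coloring_def split: option.splits if_splits)
  have new: "x p = None \<and> (p \<in> X \<longleftrightarrow> ?c p = t)" if "t \<le> ?c p" for p
    using that x ranI[of x p]
    by (fastforce simp: complete_coloring_def split: option.splits if_splits)
  obtain p q where pq: "p \<in> vertices S" "?c p = t" "q \<in> vertices S" "?c q = Suc t"
    using S(3) by (metis atMost_iff imageE le_SucI order_refl)
  have "inj_on ?c (vertices S)"
    using simplex_vertices[OF S(2)] S(3) by (simp add: eq_card_imp_inj_on)
  then have "?c ` (vertices S - {p, q}) = {..Suc t} - {t, Suc t}"
    using inj_on_image_set_diff[of ?c "vertices S" "vertices S" "{p, q}"] pq S(3) by simp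
  also have "\<dots> = {..<t}" by auto
  finally have rest: "?c ` (vertices S - {p, q}) = {..<t}" .
  then have "x w = Some (?c w)" if "w \<in> vertices S - {p, q}" for w
    using old that by blast
  then have "x ` (vertices S - {p, q}) = Some ` ?c ` (vertices S - {p, q})"
    by (simp add: image_image)
  then have "almost_panchromatic x p q S"
    unfolding almost_panchromatic_def rest using S(1,2) pq new[of p] new[of q] by simp
  then have "(p, q) \<in> almost_panchromatic_edges x" by (auto simp: almost_panchromatic_edges_def)
  with pq(2,4) new[of p] new[of q] show ?thesis using that[of p q] by simp
qed

text \<open>
  Otherwise \<open>B\<close> could legally color the points reachable from the first facet with \<open>t\<close> and the
  other ones with \<open>Suc t\<close>, and the panchromatic simplex given by Sperner's lemma would contain an
  edge leaving the reachable set.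
\<close>

lemma almost_panchromatic_edges_connect_facets:
  assumes x: "x \<in> inputs K {..<t}" "partial_sperner_coloring x"
  shows "\<exists>a b. a \<in> points K \<and> x a = None \<and> a \<in> opposite_facet (Suc t) \<and> b \<in> opposite_facet t \<and>
    (a, b) \<in> (almost_panchromatic_edges x)\<^sup>*"
proof (rule ccontr)
  assume not_connected: "\<not> ?thesis"
  define X where "X = (almost_panchromatic_edges x)\<^sup>* ``
    {a \<in> points K. x a = None \<and> a \<in> opposite_facet (Suc t)}"
  have "sperner_coloring (Suc t) v K (complete_coloring x X)"
  proof (rule sperner_coloring_complete_coloring[OF x(2)])
    show "p \<notin> opposite_facet t" if "p \<in> X" for p
      using that not_connected unfolding X_def by blast
    show "p \<notin> opposite_facet (Suc t)" if "p \<in> points K" "x p = None" "p \<notin> X" for p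
      using that unfolding X_def by blast
  qed
  then obtain S where "S \<in> K" "int (Suc t) simplex S"
    "complete_coloring x X ` vertices S = {..Suc t}"
    using sperner_panchromatic by (metis le_add1 plus_1_eq_Suc)
  then obtain p q where "p \<in> X" "q \<notin> X" "(p, q) \<in> almost_panchromatic_edges x"
    using panchromatic_complete_coloring[of x S X] x(1) by (auto simp: inputs_def)
  then show False unfolding X_def by (auto intro: rtrancl_into_rtrancl)
qed

definition facet_walk :: "('a \<rightharpoonup> nat) \<Rightarrow> nat \<Rightarrow> (nat \<Rightarrow> 'a) \<Rightarrow> bool" where
  "facet_walk x N f \<longleftrightarrow>
     f 0 \<in> opposite_facet (Suc t) \<and> f N \<in> opposite_facet t \<and>
     (\<forall>i\<le>N. f i \<in> points K \<and> x (f i) = None) \<and>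
     (\<forall>i<N. (f i, f (Suc i)) \<in> (almost_panchromatic_edges x)\<^sup>=)"

lemma facet_walk_exists:
  assumes x: "x \<in> inputs K {..<t}" "partial_sperner_coloring x"
    and N: "(card (points K))\<^sup>2 \<le> N"
  shows "\<exists>f. facet_walk x N f"
proof -
  let ?E = "almost_panchromatic_edges x"
  obtain a b where a: "a \<in> points K" "x a = None" "a \<in> opposite_facet (Suc t)"
    and b: "b \<in> opposite_facet t" and ab: "(a, b) \<in> ?E\<^sup>*"
    using almost_panchromatic_edges_connect_facets[OF x] by blast
  have finite: "finite (points K \<times> points K)"
    using finite_points[OF simplicial_complex] by simp
  have subset: "?E \<subseteq> points K \<times> points K" using almost_panchromatic_edges_subset by blast
  have "finite ?E" using finite_subset[OF subset finite] .
  moreover have "card ?E \<le> N"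
    using card_mono[OF finite subset] N by (simp add: card_cartesian_product power2_eq_square)
  ultimately have "(a, b) \<in> (?E\<^sup>=) ^^ N" using ab by (rule rtrancl_imp_relpow_reflcl)
  then obtain f where f: "f 0 = a" "f N = b" "\<forall>i<N. (f i, f (Suc i)) \<in> ?E\<^sup>="
    unfolding relpow_fun_conv by blast
  have "f i \<in> points K \<and> x (f i) = None" if "i \<le> N" for i
    using that
  proof (induction i)
    case (Suc i)
    then have "(f i, f (Suc i)) \<in> ?E\<^sup>=" using f(3) by simp
    with Suc show ?case using almost_panchromatic_edges_subset[of x] by auto
  qed (use a f(1) in simp)
  with a b f show ?thesis unfolding facet_walk_def by blast
qed

subsection \<open>The protocol\<close>

abbreviation solvable :: "nat \<Rightarrow> (('a \<rightharpoonup> nat) \<Rightarrow> ('a \<rightharpoonup> nat) \<Rightarrow> bool) \<Rightarrow> bool" where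
  "solvable \<equiv> solvable_within (sperner_answer (Suc t) v K)"

lemma inputs_B_cases:
  assumes "y \<in> inputs K {t..Suc t}"
  obtains "y z = None" | "y z = Some t" | "y z = Some (Suc t)"
proof (cases "y z")
  case (Some i)
  then have "i \<in> {t..Suc t}" using assms ranI[of y z i] by (auto simp: inputs_def)
  with Some that show ?thesis by (auto simp: le_Suc_eq)
qed

lemma violation_on_opposite_facet:
  assumes "z \<in> points K" "x z = None" "z \<in> opposite_facet i" "y z = None \<or> y z = Some i"
  shows "sperner_answer (Suc t) v K x y (Violation z)"
  using assms points_subset sperner_at_iff[of z i] by (auto simp: combine_def)

lemma panchromatic_combine:
  assumes S: "almost_panchromatic x p q S" and y: "y p = Some t" "y q = Some (Suc t)"
    and rest: "\<And>w. w \<in> vertices S - {p, q} \<Longrightarrow> y w = None"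
  shows "sperner_answer (Suc t) v K x y (Panchromatic S)"
proof -
  have "combine x y w = x w" if "w \<in> vertices S - {p, q}" for w
    using rest[OF that] by (simp add: combine_def split: option.split)
  then have old: "combine x y ` (vertices S - {p, q}) = Some ` {..<t}"
    using S by (simp add: almost_panchromatic_def)
  have new: "combine x y p = Some t" "combine x y q = Some (Suc t)"
    using S y by (simp_all add: combine_def almost_panchromatic_def)
  have "vertices S = insert p (insert q (vertices S - {p, q}))"
    using S by (auto simp: almost_panchromatic_def)
  then have "combine x y ` vertices S = combine x y ` insert p (insert q (vertices S - {p, q}))"
    by (rule arg_cong)
  also have "\<dots> = insert (Some t) (insert (Some (Suc t)) (Some ` {..<t}))"
    by (simp only: image_insert new old)
  also have "\<dots> = Some ` {..Suc t}" by (auto simp: le_Suc_eq less_le)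
  finally show ?thesis using S by (simp add: almost_panchromatic_def)
qed

lemma solvable_almost_panchromatic:
  assumes card_points: "card (points K) \<le> 2 ^ L" and "S \<in> K"
    and promise: "\<And>x y. D x y \<Longrightarrow>
      y \<in> inputs K {t..Suc t} \<and> almost_panchromatic x p q S \<and> y p = Some t \<and> y q \<noteq> Some t"
  shows "solvable (Suc L) D"
proof -
  have vertices: "vertices S \<subseteq> points K" using \<open>S \<in> K\<close> by (auto simp: points_def)
  have fin: "finite (points K)" by (rule finite_points[OF simplicial_complex])
  have "solvable (Suc (L + 0)) D"
  proof (rule solvable_within_check_B[where ans = Violation and Z = "vertices S"
        and W = "\<lambda>y w. w \<in> {p, q} \<longleftrightarrow> y w = None"])
    show "finite (vertices S)" using vertices fin by (rule finite_subset)
    show "card (vertices S) \<le> 2 ^ L" using card_mono[OF fin vertices] card_points by simp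
    fix x y w assume xy: "D x y" and w: "w \<in> vertices S" "w \<in> {p, q} \<longleftrightarrow> y w = None"
    then have "x w = None \<longleftrightarrow> w \<in> {p, q}"
      using promise[OF xy] almost_panchromatic_eq_None_iff[of x p q S w] by simp
    with w vertices show "sperner_answer (Suc t) v K x y (Violation w)" by auto
  next
    show "solvable 0 (\<lambda>x y. D x y \<and> (\<forall>w\<in>vertices S. \<not> (w \<in> {p, q} \<longleftrightarrow> y w = None)))"
    proof (rule solvable_within_answer[where z = "Panchromatic S"])
      fix x y assume known: "D x y \<and> (\<forall>w\<in>vertices S. \<not> (w \<in> {p, q} \<longleftrightarrow> y w = None))"
      then have S: "almost_panchromatic x p q S" and y: "y p = Some t" "y q \<noteq> Some t"
        and "y \<in> inputs K {t..Suc t}" using promise by blast+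
      have "y q \<noteq> None" using known S by (auto simp: almost_panchromatic_def)
      with y(2) have "y q = Some (Suc t)"
        using inputs_B_cases[OF \<open>y \<in> inputs K {t..Suc t}\<close>] by metis
      with S y(1) show "sperner_answer (Suc t) v K x y (Panchromatic S)"
        by (rule panchromatic_combine) (use known in blast)
    qed
  qed
  then show ?thesis by simp
qed

lemma solvable_almost_panchromatic_edge:
  assumes card_points: "card (points K) \<le> 2 ^ L"
    and promise: "\<And>x y. D x y \<Longrightarrow> y \<in> inputs K {t..Suc t} \<and>
      (p x, q x) \<in> almost_panchromatic_edges x \<and> y (p x) = Some t \<and> y (q x) \<noteq> Some t"
  shows "solvable ((t + 4) * L + Suc L) D"
proof -
  let ?Z = "points K \<times> points K \<times> {S \<in> K. int (Suc t) simplex S}"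
  define S where "S x = (SOME S. almost_panchromatic x (p x) (q x) S)" for x
  have S: "almost_panchromatic x (p x) (q x) (S x)" if "D x y" for x y
    using promise[OF that] unfolding almost_panchromatic_edges_def S_def by (auto intro: someI)
  show ?thesis
  proof (rule solvable_within_announce_A[where e = "\<lambda>x. (p x, q x, S x)"])
    show "finite ?Z"
      using finite_points[OF simplicial_complex] simplicial_complex
      by (simp add: simplicial_complex_def)
    have "card ?Z \<le> card (points K) * (card (points K) * card (points K) ^ Suc (Suc t))"
      unfolding card_cartesian_product
      by (intro mult_le_mono le_refl card_simplices_le simplicial_complex)
    also have "\<dots> = card (points K) ^ (t + 4)" by (simp add: eval_nat_numeral)
    also have "\<dots> \<le> (2 ^ L) ^ (t + 4)" using card_points by (rule power_mono) simp
    finally show "card ?Z \<le> 2 ^ ((t + 4) * L)" by (simp only: mult.commute power_mult)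
    show "(p x, q x, S x) \<in> ?Z" if "D x y" for x y
      using S[OF that] by (auto simp: almost_panchromatic_def points_def)
    fix z assume z: "z \<in> ?Z"
    show "solvable (Suc L) (\<lambda>x y. D x y \<and> (p x, q x, S x) = z)"
    proof (rule solvable_almost_panchromatic[OF card_points])
      show "snd (snd z) \<in> K" using z by auto
      fix x y assume "D x y \<and> (p x, q x, S x) = z"
      then show "y \<in> inputs K {t..Suc t} \<and>
        almost_panchromatic x (fst z) (fst (snd z)) (snd (snd z)) \<and>
        y (fst z) = Some t \<and> y (fst (snd z)) \<noteq> Some t"
        using promise[of x y] S[of x y] by auto
    qed
  qed
qed

lemma solvable_facet_walk_color_change:
  assumes card_points: "card (points K) \<le> 2 ^ L"
    and promise: "\<And>x y. D x y \<Longrightarrow> y \<in> inputs K {t..Suc t} \<and> facet_walk x (2 ^ r) (f x)"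
  shows "solvable (r * Suc L + ((t + 4) * L + Suc L))
    (\<lambda>x y. D x y \<and> y (f x 0) = Some t \<and> y (f x (2 ^ r)) \<noteq> Some t)"
proof -
  have "solvable (r * Suc L + ((t + 4) * L + Suc L))
    (\<lambda>x y. D x y \<and> y (f x 0) = Some t \<and> y (f x (0 + 2 ^ r)) \<noteq> Some t)"
  proof (rule solvable_within_binary_search[where q = "\<lambda>y z. y z = Some t" and Z = "points K"])
    show "finite (points K)" by (rule finite_points[OF simplicial_complex])
    show "f x i \<in> points K" if "D x y" "i \<le> 2 ^ r" for x y i
      using promise[OF that(1)] that(2) by (simp add: facet_walk_def)
    show "solvable ((t + 4) * L + Suc L)
      (\<lambda>x y. D x y \<and> y (f x i) = Some t \<and> y (f x (Suc i)) \<noteq> Some t)" if "i < 2 ^ r" for i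
    proof (rule solvable_almost_panchromatic_edge[OF card_points])
      fix x y assume known: "D x y \<and> y (f x i) = Some t \<and> y (f x (Suc i)) \<noteq> Some t"
      then have "f x i \<noteq> f x (Suc i)" by auto
      with known that promise[of x y]
      show "y \<in> inputs K {t..Suc t} \<and> (f x i, f x (Suc i)) \<in> almost_panchromatic_edges x \<and>
        y (f x i) = Some t \<and> y (f x (Suc i)) \<noteq> Some t" by (auto simp: facet_walk_def)
    qed
  qed (use card_points in simp_all)
  then show ?thesis by simp
qed

lemma solvable_facet_walk:
  assumes card_points: "card (points K) \<le> 2 ^ L"
    and promise: "\<And>x y. D x y \<Longrightarrow> y \<in> inputs K {t..Suc t} \<and> facet_walk x (2 ^ r) (f x)"
  shows "solvable (L + Suc (L + Suc (r * Suc L + ((t + 4) * L + Suc L)))) D"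
proof -
  let ?m = "r * Suc L + ((t + 4) * L + Suc L)"
  note query = solvable_within_query[where q = "\<lambda>y z. y z = Some t",
      OF finite_points[OF simplicial_complex] card_points]
  have walk: "f x i \<in> points K" "x (f x i) = None" if "D x y" "i \<le> 2 ^ r" for x y i
    using promise[OF that(1)] that(2) by (simp_all add: facet_walk_def)
  have violation: "sperner_answer (Suc t) v K x y (Violation z)"
    if "D x y" "z = f x 0 \<and> y z \<noteq> Some t \<or> z = f x (2 ^ r) \<and> y z = Some t" for x y z
  proof -
    have "y z = None \<or> y z = Some t \<or> y z = Some (Suc t)"
      using promise[OF that(1)] inputs_B_cases by metis
    with that promise[OF that(1)] obtain i where "z \<in> opposite_facet i" "y z = None \<or> y z = Some i"
      by (auto simp: facet_walk_def)
    then show ?thesis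
      using that walk[OF that(1)] by (intro violation_on_opposite_facet[where i = i]) auto
  qed
  show ?thesis
  proof (rule query[where e = "\<lambda>x. f x 0"])
    fix a
    show "solvable (L + Suc ?m) (\<lambda>x y. D x y \<and> f x 0 = a \<and> y a \<noteq> Some t)"
      using violation by (intro solvable_within_answer[where z = "Violation a"]) blast
    let ?D = "\<lambda>x y. D x y \<and> f x 0 = a \<and> y a = Some t"
    show "solvable (L + Suc ?m) ?D"
    proof (rule query[where e = "\<lambda>x. f x (2 ^ r)"])
      fix b
      show "solvable ?m (\<lambda>x y. ?D x y \<and> f x (2 ^ r) = b \<and> y b = Some t)"
        using violation by (intro solvable_within_answer[where z = "Violation b"]) blast
      show "solvable ?m (\<lambda>x y. ?D x y \<and> f x (2 ^ r) = b \<and> y b \<noteq> Some t)"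
        using solvable_facet_walk_color_change[where D = D, OF card_points promise]
        by (rule solvable_within_mono) auto
    qed (use walk in blast)
  qed (use walk in blast)
qed

lemma concatenated_sperner_protocol_exists:
  assumes card_points: "card (points K) \<le> 2 ^ L" and "1 \<le> L"
  shows "\<exists>P. solves_Sp t (Suc t) v K P \<and> cost P \<le> (t + 16) * L\<^sup>2"
proof -
  let ?I = "\<lambda>x y. x \<in> inputs K {..<t} \<and> y \<in> inputs K {t..Suc t}"
  let ?wrong = "\<lambda>x p. p \<in> dom x \<and> \<not> sperner_at (Suc t) v p (the (x p))"
  let ?m = "L + Suc (L + Suc (2 * L * Suc L + ((t + 4) * L + Suc L)))"
  define f where "f x = (SOME f. facet_walk x (2 ^ (2 * L)) f)" for x
  have "(card (points K))\<^sup>2 \<le> 2 ^ (2 * L)"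
    using power_mono[OF card_points, of 2] by (simp add: mult.commute flip: power_mult)
  then have f: "facet_walk x (2 ^ (2 * L)) (f x)"
    if "x \<in> inputs K {..<t}" "partial_sperner_coloring x" for x
    unfolding f_def using that by (intro someI_ex[OF facet_walk_exists])
  have "solvable (Suc (L + ?m)) ?I"
  proof (rule solvable_within_check_A[where W = ?wrong and ans = Violation])
    show "finite (points K)" by (rule finite_points[OF simplicial_complex])
    show "sperner_answer (Suc t) v K x y (Violation p)" if "p \<in> points K" "?wrong x p" for x y p
      using that by (cases "y p") (auto simp: combine_def)
    show "solvable ?m (\<lambda>x y. ?I x y \<and> (\<forall>p\<in>points K. \<not> ?wrong x p))"
    proof (rule solvable_facet_walk[OF card_points])
      fix x y assume known: "?I x y \<and> (\<forall>p\<in>points K. \<not> ?wrong x p)"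
      then have "partial_sperner_coloring x"
        unfolding partial_sperner_coloring_def inputs_def by blast
      with known f show "y \<in> inputs K {t..Suc t} \<and> facet_walk x (2 ^ (2 * L)) (f x)" by blast
    qed
  qed (rule card_points)
  moreover have "Suc (L + ?m) \<le> (t + 16) * L\<^sup>2"
  proof -
    have "L \<le> L\<^sup>2" "1 \<le> L\<^sup>2" using \<open>1 \<le> L\<close> by (simp_all add: power2_eq_square)
    then have "2 * L\<^sup>2 + (t + 10) * L + 4 * 1 \<le> 2 * L\<^sup>2 + (t + 10) * L\<^sup>2 + 4 * L\<^sup>2"
      by (intro add_mono mult_left_mono) auto
    then show ?thesis by (simp add: algebra_simps power2_eq_square)
  qed
  ultimately have "solvable ((t + 16) * L\<^sup>2) ?I" by (rule solvable_within_mono) simp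
  then show ?thesis
    unfolding solvable_within_def solves_Sp_def solves_def by blast
qed

end

theorem theorem1p4:
  fixes d :: nat
  assumes "d \<ge> 1"
  shows "\<exists>f :: nat \<Rightarrow> real. f \<in> O(\<lambda>n. (log 2 (real n))\<^sup>2) \<and>
    (\<forall>n>d. \<forall>(v :: nat \<Rightarrow> 'a::euclidean_space) (K :: 'a set set).
       nondegenerate d v \<and> triangulates K (big_simplex d v) \<and> card (points K) = n \<longrightarrow>
       (\<exists>P :: ('a \<rightharpoonup> nat, 'a \<rightharpoonup> nat, 'a answer) protocol.
          solves_Sp (d - 1) d v K P \<and> real (cost P) \<le> f n))"
proof -
  obtain t where t: "d = Suc t" using assms by (cases d) auto
  define f where "f n = real (d + 15) * (2 * log 2 (real n))\<^sup>2" for n :: nat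
  have "\<exists>P. solves_Sp (d - 1) d v K P \<and> real (cost P) \<le> f n"
    if simplex: "nondegenerate d v" "triangulates K (big_simplex d v)"
      and n: "n > d" "card (points K) = n"
    for n and v :: "nat \<Rightarrow> 'a" and K
  proof -
    interpret concatenated_sperner t v K using simplex unfolding t by unfold_locales
    define L where "L = ceillog2 n"
    have "1 \<le> log 2 (real n)" using n(1) assms by (simp add: le_log_iff)
    then have L: "1 \<le> L" "real L \<le> 2 * log 2 (real n)"
      using ceillog2_ge_log[of n] ceillog2_less_log[of n] n(1) unfolding L_def by linarith+
    have "card (points K) \<le> 2 ^ L" unfolding n(2) L_def by (rule le_two_power_ceillog2)
    then obtain P where P: "solves_Sp (d - 1) d v K P" "cost P \<le> (d + 15) * L\<^sup>2"
      using concatenated_sperner_protocol_exists[OF _ L(1)] by (auto simp: t add.commute)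
    have "real (cost P) \<le> real (d + 15) * (real L)\<^sup>2"
      using P(2) by (metis of_nat_le_iff of_nat_mult of_nat_power)
    also have "\<dots> \<le> f n" unfolding f_def using L by (intro mult_left_mono power_mono) auto
    finally show ?thesis using P(1) by blast
  qed
  moreover have "f \<in> O(\<lambda>n. (log 2 (real n))\<^sup>2)" unfolding f_def by (simp add: power_mult_distrib)
  ultimately show ?thesis by blast
qed

end
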